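(* There exist a real Banach space $X$ and a nonempty weakly compact subset $C$ of $X$ such that the set of all $x \in X$ for which the function $z \mapsto \|z-x\| + \|z\|$ attains its supremum on $C$ is not (norm) dense in $X$.
   Context: A function $g : C \to \mathbb{R}$ attains its supremum on $C$ if there is $z_0 \in C$ with $g(z_0) = \sup_{z \in C} g(z)$. *)

theory Defs
  imports "HOL-Analysis.Analysis" "HOL-Algebra.Module"
begin

(* HOL cannot quantify existentially over types, so the type class banach cannot express
   "there exists a Banach space X". Banach spaces are therefore structures with an explicit
   carrier set and explicit operations: modules over the reals in the sense of HOL-Algebra,
   extended by a norm. The ring fields mult and one of a module are never used. *)

definition real_ring :: "real ring" where
  "real_ring = \<lparr>carrier = UNIV, mult = (*), one = 1, zero = 0, add = (+)\<rparr>"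

record 'a nvs = "(real, 'a) module" +
  nrm :: "'a \<Rightarrow> real"

locale normed_space = Module.module real_ring X for X :: "('a, 'b) nvs_scheme" (structure) +
  assumes nrm_eq_zero: "x \<in> carrier X \<Longrightarrow> nrm X x = 0 \<longleftrightarrow> x = \<zero>"
    and nrm_triangle: "\<lbrakk>x \<in> carrier X; y \<in> carrier X\<rbrakk> \<Longrightarrow> nrm X (x \<oplus> y) \<le> nrm X x + nrm X y"
    and nrm_smult: "x \<in> carrier X \<Longrightarrow> nrm X (a \<odot> x) = \<bar>a\<bar> * nrm X x"

(* The locale Metric_space requires nonnegativity and symmetry of the distance
   also outside the carrier, hence the case distinction. *)
definition norm_dist :: "('a, 'b) nvs_scheme \<Rightarrow> 'a \<Rightarrow> 'a \<Rightarrow> real" where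
  "norm_dist X x y =
     (if x \<in> carrier X \<and> y \<in> carrier X then nrm X (x \<ominus>\<^bsub>X\<^esub> y) else 0)"

definition norm_topology :: "('a, 'b) nvs_scheme \<Rightarrow> 'a topology" where
  "norm_topology X = Metric_space.mtopology (carrier X) (norm_dist X)"

locale banach_space = normed_space +
  assumes complete: "Metric_space.mcomplete (carrier X) (norm_dist X)"

(* Functionals are unconstrained outside the carrier. *)
definition dual_space :: "('a, 'b) nvs_scheme \<Rightarrow> ('a \<Rightarrow> real) set" where
  "dual_space X =
     {f. (\<forall>x\<in>carrier X. \<forall>y\<in>carrier X. f (x \<oplus>\<^bsub>X\<^esub> y) = f x + f y) \<and>
         (\<forall>a. \<forall>x\<in>carrier X. f (a \<odot>\<^bsub>X\<^esub> x) = a * f x) \<and>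
         (\<exists>K. \<forall>x\<in>carrier X. \<bar>f x\<bar> \<le> K * nrm X x)}"

definition weak_topology :: "('a, 'b) nvs_scheme \<Rightarrow> 'a topology" where
  "weak_topology X =
     topology_generated_by {{x \<in> carrier X. f x \<in> U} | f U. f \<in> dual_space X \<and> open U}"

(* The supremum is taken in the extended reals, because SUP on real is
   unspecified for functions that are unbounded above. *)
definition attains_sup_on :: "('a \<Rightarrow> real) \<Rightarrow> 'a set \<Rightarrow> bool" where
  "attains_sup_on g C \<longleftrightarrow> (\<exists>z\<^sub>0\<in>C. ereal (g z\<^sub>0) = (SUP z\<in>C. ereal (g z)))"

context normed_space
begin

lemma minus_one_smult: "x \<in> carrier X \<Longrightarrow> (-1) \<odot> x = \<ominus> x"
proof -
  assume x: "x \<in> carrier X"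
  have "(-1) \<odot> x \<oplus> x = ((-1) \<odot> x) \<oplus> (1 \<odot> x)"
    using x smult_one by (simp add: real_ring_def)
  also have "\<dots> = 0 \<odot> x"
    using x smult_l_distr[of "-1" 1 x] by (simp add: real_ring_def)
  also have "\<dots> = \<zero>"
    using x smult_l_null[of x] by (simp add: real_ring_def)
  finally show ?thesis
    using x smult_closed[of "-1" x] M.minus_equality by (simp add: real_ring_def)
qed

lemma nrm_minus: "x \<in> carrier X \<Longrightarrow> nrm X (\<ominus> x) = nrm X x"
  using nrm_smult[of x "-1"] by (simp add: minus_one_smult)

lemma nrm_nonneg: "x \<in> carrier X \<Longrightarrow> 0 \<le> nrm X x"
  using nrm_triangle[of x "\<ominus> x"] nrm_eq_zero[of \<zero>]
  by (simp add: nrm_minus M.r_neg)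

lemma Metric_space_norm_dist: "Metric_space (carrier X) (norm_dist X)"
proof
  fix x y
  show "0 \<le> norm_dist X x y"
    by (simp add: norm_dist_def nrm_nonneg)
  have "\<ominus> (x \<ominus> y) = y \<ominus> x" if "x \<in> carrier X" "y \<in> carrier X"
    using that by (simp add: a_minus_def M.minus_add M.a_comm)
  then show "norm_dist X x y = norm_dist X y x"
    using nrm_minus[of "x \<ominus> y"] by (auto simp: norm_dist_def)
next
  fix x y assume xy: "x \<in> carrier X" "y \<in> carrier X"
  have "x \<ominus> y = \<zero> \<longleftrightarrow> x = y"
    using xy M.minus_equality[of x "\<ominus> y"] by (auto simp: a_minus_def M.r_neg)
  with xy show "norm_dist X x y = 0 \<longleftrightarrow> x = y"
    by (simp add: norm_dist_def nrm_eq_zero)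
next
  fix x y z assume xyz: "x \<in> carrier X" "y \<in> carrier X" "z \<in> carrier X"
  have "x \<ominus> z = (x \<ominus> y) \<oplus> (y \<ominus> z)"
    using xyz by (simp add: a_minus_def M.a_assoc M.r_neg1)
  then show "norm_dist X x z \<le> norm_dist X x y + norm_dist X y z"
    using xyz nrm_triangle[of "x \<ominus> y" "y \<ominus> z"] by (simp add: norm_dist_def)
qed

lemma topspace_norm_topology: "topspace (norm_topology X) = carrier X"
  by (simp add: norm_topology_def Metric_space.topspace_mtopology[OF Metric_space_norm_dist])

lemma topspace_weak_topology: "topspace (weak_topology X) = carrier X"
proof -
  have "(\<lambda>_. 0) \<in> dual_space X"
    using nrm_nonneg by (auto simp: dual_space_def intro!: exI[of _ 0])
  then have "carrier X \<in> {{x \<in> carrier X. f x \<in> U} | f U. f \<in> dual_space X \<and> open U}"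
    by (auto intro!: exI[of _ "\<lambda>_. 0"] exI[of _ UNIV])
  then show ?thesis
    unfolding weak_topology_def by auto
qed

end

end

(* In c_0 the points z_n = (n / (n + 1)) e_(n+1) converge weakly to 0 = z_0, so they form a weakly
   compact set. Every x within distance 1 of 3 e_0 has |x_0| > 2, while the other coordinates of
   z_n - x are at most 2; hence the norm of z_n - x is |x_0| for all n. The function in question is
   therefore |x_0| + n / (n + 1) at z_n, which is strictly increasing in n. *)

theory Submission
  imports Defs
begin

section \<open>The Banach space c_0 with the supremum norm\<close>

definition c0_space :: "(nat \<Rightarrow> real) nvs" where
  "c0_space = \<lparr>carrier = {x. x \<longlonglongrightarrow> 0}, mult = (\<lambda>x y i. x i * y i), one = (\<lambda>i. 1),
     zero = (\<lambda>i. 0), add = (\<lambda>x y i. x i + y i), smult = (\<lambda>a x i. a * x i),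
     nrm = (\<lambda>x. SUP i. \<bar>x i\<bar>)\<rparr>"

lemma c0_simps [simp]:
  "carrier c0_space = {x. x \<longlonglongrightarrow> 0}"
  "\<zero>\<^bsub>c0_space\<^esub> = (\<lambda>i. 0)"
  "x \<oplus>\<^bsub>c0_space\<^esub> y = (\<lambda>i. x i + y i)"
  "a \<odot>\<^bsub>c0_space\<^esub> x = (\<lambda>i. a * x i)"
  by (simp_all add: c0_space_def)

lemma nrm_c0: "nrm c0_space x = (SUP i. \<bar>x i\<bar>)"
  by (simp add: c0_space_def)

text \<open>A convergent sequence is bounded, so the real supremum in the norm is a genuine least
  upper bound; for unbounded sequences it would be an unspecified value.\<close>

lemma abs_le_nrm_c0:
  assumes "x \<longlonglongrightarrow> 0"
  shows "\<bar>x i\<bar> \<le> nrm c0_space x"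
proof -
  from assms have "Bseq x"
    by (blast intro: convergentI convergent_imp_Bseq)
  then have "bdd_above (range (\<lambda>i. \<bar>x i\<bar>))"
    unfolding Bseq_def bdd_above_def by auto
  then show ?thesis
    unfolding nrm_c0 by (rule cSUP_upper2) auto
qed

lemma nrm_c0_le: "(\<And>i. \<bar>x i\<bar> \<le> B) \<Longrightarrow> nrm c0_space x \<le> B"
  unfolding nrm_c0 by (rule cSUP_least) auto

lemma nrm_c0_eqI: "(\<And>i. \<bar>x i\<bar> \<le> B) \<Longrightarrow> \<bar>x j\<bar> = B \<Longrightarrow> nrm c0_space x = B"
  unfolding nrm_c0 by (rule cSup_eq_maximum) auto

interpretation c0: normed_space c0_space
proof (unfold normed_space_def, intro conjI)
  have "cring real_ring"
  proof (rule cringI)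
    show "abelian_group real_ring"
    proof (rule abelian_groupI)
      fix x :: real
      show "\<exists>y\<in>carrier real_ring. y \<oplus>\<^bsub>real_ring\<^esub> x = \<zero>\<^bsub>real_ring\<^esub>"
        by (intro bexI[of _ "-x"]) (simp_all add: real_ring_def)
    qed (simp_all add: real_ring_def)
    show "comm_monoid real_ring"
      by (rule comm_monoidI) (simp_all add: real_ring_def)
  qed (simp add: real_ring_def algebra_simps)
  moreover have "abelian_group c0_space"
  proof (rule abelian_groupI)
    fix x assume "x \<in> carrier c0_space"
    then show "\<exists>y\<in>carrier c0_space. y \<oplus>\<^bsub>c0_space\<^esub> x = \<zero>\<^bsub>c0_space\<^esub>"
      by (intro bexI[of _ "\<lambda>i. - x i"]) (auto intro: tendsto_minus[where a = 0, simplified])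
  qed (auto simp: add.assoc add.commute intro: tendsto_add_zero)
  ultimately show "Module.module real_ring c0_space"
    by (rule module.intro[OF _ _ module_axioms.intro])
       (auto simp: real_ring_def algebra_simps intro: tendsto_mult_right_zero)
  show "normed_space_axioms c0_space"
  proof
    fix x :: "nat \<Rightarrow> real" assume "x \<in> carrier c0_space"
    then have x: "x \<longlonglongrightarrow> 0" by simp
    show "nrm c0_space x = 0 \<longleftrightarrow> x = \<zero>\<^bsub>c0_space\<^esub>"
    proof
      assume "nrm c0_space x = 0"
      with abs_le_nrm_c0[OF x] show "x = \<zero>\<^bsub>c0_space\<^esub>" by (auto simp: fun_eq_iff)
    qed (simp add: nrm_c0)
    show "nrm c0_space (a \<odot>\<^bsub>c0_space\<^esub> x) = \<bar>a\<bar> * nrm c0_space x" for a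
    proof (cases "a = 0")
      case False
      have "nrm c0_space (a \<odot>\<^bsub>c0_space\<^esub> x) \<le> \<bar>a\<bar> * nrm c0_space x"
        by (rule nrm_c0_le) (simp add: abs_mult mult_left_mono abs_le_nrm_c0[OF x])
      \<comment> \<open>The reverse inequality is the coordinate bound for \<open>a * x\<close>,
        divided by \<bar>a\<bar>; this is why a = 0 is split off.\<close>
      moreover have "nrm c0_space x \<le> nrm c0_space (\<lambda>i. a * x i) / \<bar>a\<bar>"
      proof (rule nrm_c0_le)
        fix i
        from abs_le_nrm_c0[OF tendsto_mult_right_zero[OF x], of a i] False
        show "\<bar>x i\<bar> \<le> nrm c0_space (\<lambda>i. a * x i) / \<bar>a\<bar>"
          by (simp add: abs_mult field_simps)
      qed
      ultimately show ?thesis using False by (simp add: field_simps)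
    qed (simp add: nrm_c0)
    fix y :: "nat \<Rightarrow> real" assume "y \<in> carrier c0_space"
    then have y: "y \<longlonglongrightarrow> 0" by simp
    show "nrm c0_space (x \<oplus>\<^bsub>c0_space\<^esub> y) \<le> nrm c0_space x + nrm c0_space y"
    proof (rule nrm_c0_le)
      fix i
      show "\<bar>(x \<oplus>\<^bsub>c0_space\<^esub> y) i\<bar> \<le> nrm c0_space x + nrm c0_space y"
        using abs_le_nrm_c0[OF x, of i] abs_le_nrm_c0[OF y, of i] by simp
    qed
  qed
qed

text \<open>The carrier is spelled out as the set of null sequences because \<open>c0_simps\<close>
  rewrites \<open>carrier c0_space\<close> to this form.\<close>

interpretation c0: Metric_space "{x. x \<longlonglongrightarrow> 0}" "norm_dist c0_space"
  using c0.Metric_space_norm_dist by simp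

text \<open>Subtraction comes from the abstract inverse of the additive group, so it is computed
  through multiplication by -1.\<close>

lemma c0_minus:
  assumes "x \<longlonglongrightarrow> 0" "y \<longlonglongrightarrow> 0"
  shows "x \<ominus>\<^bsub>c0_space\<^esub> y = (\<lambda>i. x i - y i)"
  using assms by (simp add: a_minus_def flip: c0.minus_one_smult)

lemma norm_dist_c0:
  "x \<longlonglongrightarrow> 0 \<Longrightarrow> y \<longlonglongrightarrow> 0 \<Longrightarrow> norm_dist c0_space x y = nrm c0_space (\<lambda>i. x i - y i)"
  by (simp add: norm_dist_def c0_minus)

lemma abs_diff_le_norm_dist_c0:
  "x \<longlonglongrightarrow> 0 \<Longrightarrow> y \<longlonglongrightarrow> 0 \<Longrightarrow> \<bar>x i - y i\<bar> \<le> norm_dist c0_space x y"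
  using abs_le_nrm_c0[OF tendsto_diff[where a = 0 and b = 0, simplified]] by (simp add: norm_dist_c0)

text \<open>A Cauchy sequence in the supremum norm is Cauchy uniformly in the coordinates. Its
  coordinatewise limit is therefore a uniform limit, and a uniform limit of null sequences is a null
  sequence.\<close>

lemma mcomplete_c0: "c0.mcomplete"
  unfolding c0.mcomplete_def
proof (intro allI impI)
  fix s assume "c0.MCauchy s"
  then have s: "\<And>n. s n \<longlonglongrightarrow> 0"
    and cauchy: "\<And>e. e > 0 \<Longrightarrow> \<exists>N. \<forall>n n'. N \<le> n \<longrightarrow> N \<le> n' \<longrightarrow> norm_dist c0_space (s n) (s n') < e"
    unfolding c0.MCauchy_def by auto
  have unif: "\<exists>N. \<forall>m\<ge>N. \<forall>n\<ge>N. \<forall>i. \<bar>s m i - s n i\<bar> < e" if "e > 0" for e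
    using cauchy[OF that] abs_diff_le_norm_dist_c0[OF s s] le_less_trans by blast
  have "Cauchy (\<lambda>n. s n i)" for i
  proof (rule CauchyI)
    fix e :: real assume "e > 0"
    from unif[OF this] show "\<exists>M. \<forall>m\<ge>M. \<forall>n\<ge>M. norm (s m i - s n i) < e"
      unfolding real_norm_def by metis
  qed
  then have "convergent (\<lambda>n. s n i)" for i
    by (rule Cauchy_convergent)
  then obtain l where l: "\<And>i. (\<lambda>n. s n i) \<longlonglongrightarrow> l i"
    unfolding convergent_def by metis
  \<comment> \<open>Letting m tend to infinity in \<open>unif\<close> makes the strict bound weak;
    \<open>e/2\<close> is used below to regain strictness.\<close>
  have lim: "\<exists>N. \<forall>n\<ge>N. \<forall>i. \<bar>s n i - l i\<bar> \<le> e" if "e > 0" for e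
  proof -
    from unif[OF that] obtain N where N: "\<And>m n i. m \<ge> N \<Longrightarrow> n \<ge> N \<Longrightarrow> \<bar>s m i - s n i\<bar> < e"
      by blast
    have "\<bar>s n i - l i\<bar> \<le> e" if "n \<ge> N" for n i
    proof (rule tendsto_upperbound)
      show "(\<lambda>m. \<bar>s n i - s m i\<bar>) \<longlonglongrightarrow> \<bar>s n i - l i\<bar>"
        by (intro tendsto_intros l)
      show "\<forall>\<^sub>F m in sequentially. \<bar>s n i - s m i\<bar> \<le> e"
        using N that by (auto simp: eventually_sequentially intro!: exI[of _ N] less_imp_le)
    qed simp
    then show ?thesis by blast
  qed
  have "l \<longlonglongrightarrow> 0"
  proof (rule LIMSEQ_I)
    fix e :: real assume e: "e > 0"
    from lim[of "e/2"] e obtain n where n: "\<And>i. \<bar>s n i - l i\<bar> \<le> e/2" by auto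
    from LIMSEQ_D[OF s, of "e/2" n] e obtain N where "\<And>i. i \<ge> N \<Longrightarrow> \<bar>s n i\<bar> < e/2" by auto
    with n have "\<bar>l i\<bar> < e" if "i \<ge> N" for i
      using that by (smt (verit) field_sum_of_halves)
    then show "\<exists>N. \<forall>i\<ge>N. norm (l i - 0) < e" by auto
  qed
  moreover have "\<exists>N. \<forall>n\<ge>N. s n \<in> {x. x \<longlonglongrightarrow> 0} \<and> norm_dist c0_space (s n) l < e" if "e > 0" for e
  proof -
    from lim[of "e/2"] that obtain N where "\<And>n i. n \<ge> N \<Longrightarrow> \<bar>s n i - l i\<bar> \<le> e/2" by auto
    then have "norm_dist c0_space (s n) l \<le> e/2" if "n \<ge> N" for n
      using that unfolding norm_dist_c0[OF s \<open>l \<longlonglongrightarrow> 0\<close>] by (intro nrm_c0_le)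
    then show ?thesis using s \<open>e > 0\<close> by (intro exI[of _ N]) force
  qed
  ultimately show "\<exists>x. limitin c0.mtopology s x sequentially"
    by (auto simp: c0.limit_metric_sequentially)
qed

lemma banach_space_c0: "banach_space c0_space"
  using mcomplete_c0 by unfold_locales simp

section \<open>Weak convergence tested on functionals\<close>

text \<open>Preimages of open sets under functionals generate the weak topology, and the property of
  eventually containing \<open>s n\<close> whenever \<open>l\<close> is a member passes to finite
  intersections and arbitrary unions.\<close>

lemma limitin_weak_topology:
  assumes "normed_space X" and l: "l \<in> carrier X" and s: "\<And>n. s n \<in> carrier X"
    and lim: "\<And>f. f \<in> dual_space X \<Longrightarrow> ((\<lambda>n. f (s n)) \<longlongrightarrow> f l) F"
  shows "limitin (weak_topology X) s l F"
  unfolding limitin_def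
proof (intro conjI allI impI)
  show "l \<in> topspace (weak_topology X)"
    using l by (simp add: normed_space.topspace_weak_topology[OF assms(1)])
  fix U assume U: "openin (weak_topology X) U \<and> l \<in> U"
  then have "generate_topology_on {{x \<in> carrier X. f x \<in> V} | f V. f \<in> dual_space X \<and> open V} U"
    by (simp add: weak_topology_def openin_topology_generated_by_iff)
  \<comment> \<open>Membership of \<open>l\<close> is kept as a premise of the induction claim,
    since in a union only some member need contain \<open>l\<close>.\<close>
  then have "l \<in> U \<Longrightarrow> \<forall>\<^sub>F n in F. s n \<in> U"
  proof induction
    case (Int a b)
    then show ?case by (auto intro: eventually_conj)
  next
    case (UN K)
    then obtain k where "k \<in> K" "\<forall>\<^sub>F n in F. s n \<in> k" by blast
    then show ?case by (auto elim: eventually_mono)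
  next
    case (Basis b)
    then obtain f V where "f \<in> dual_space X" "open V" "b = {x \<in> carrier X. f x \<in> V}" by blast
    with lim[of f] Basis.prems s show ?case by (auto dest: topological_tendstoD)
  qed simp
  with U show "\<forall>\<^sub>F n in F. s n \<in> U" by blast
qed

section \<open>The unit vectors are weakly null\<close>

definition c0_unit :: "nat \<Rightarrow> nat \<Rightarrow> real" where
  "c0_unit n = (\<lambda>i. if i = n then 1 else 0)"

lemma finite_support_tendsto_0:
  fixes x :: "nat \<Rightarrow> real"
  assumes "\<And>i. i \<ge> N \<Longrightarrow> x i = 0"
  shows "x \<longlonglongrightarrow> 0"
  by (rule tendsto_eventually) (use assms in \<open>auto simp: eventually_sequentially\<close>)

lemma c0_unit_tendsto: "c0_unit n \<longlonglongrightarrow> 0"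
  by (rule finite_support_tendsto_0[of "Suc n"]) (simp add: c0_unit_def)

text \<open>This is the embedding of the dual of c_0 into l^1: on sign vectors of finite support,
  which have norm at most 1, a bounded functional takes the values \<Sum> \<bar>f(e_n)\<bar>. These
  sums are bounded, so the series converges and its terms tend to 0.\<close>

lemma dual_c0_unit_tendsto:
  assumes "f \<in> dual_space c0_space"
  shows "(\<lambda>n. f (c0_unit n)) \<longlonglongrightarrow> 0"
proof -
  from assms obtain K where
    add: "\<And>x y. x \<longlonglongrightarrow> 0 \<Longrightarrow> y \<longlonglongrightarrow> 0 \<Longrightarrow> f (\<lambda>i. x i + y i) = f x + f y" and
    smult: "\<And>a x. x \<longlonglongrightarrow> 0 \<Longrightarrow> f (\<lambda>i. a * x i) = a * f x" and
    K: "\<And>x. x \<longlonglongrightarrow> 0 \<Longrightarrow> \<bar>f x\<bar> \<le> K * nrm c0_space x"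
    unfolding dual_space_def by auto
  \<comment> \<open>With these signs each term \<open>s n * f (c0_unit n)\<close> equals
    \<bar>f(e_n)\<bar>.\<close>
  define s where "s n = sgn (f (c0_unit n))" for n
  define p where "p N = (\<lambda>i. if i < N then s i else 0)" for N
  have p: "p N \<longlonglongrightarrow> 0" for N
    by (rule finite_support_tendsto_0[of N]) (simp add: p_def)
  have sum: "f (p N) = (\<Sum>n<N. \<bar>f (c0_unit n)\<bar>)" for N
  proof (induction N)
    case 0
    then show ?case using smult[OF p, of 0 0] by (simp add: p_def)
  next
    case (Suc N)
    have "p (Suc N) = (\<lambda>i. p N i + s N * c0_unit N i)"
      by (auto simp: p_def c0_unit_def fun_eq_iff less_Suc_eq)
    then have "f (p (Suc N)) = f (p N) + s N * f (c0_unit N)"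
      using add[OF p tendsto_mult_right_zero[OF c0_unit_tendsto]] smult[OF c0_unit_tendsto] by simp
    with Suc show ?case by (simp add: s_def sgn_mult_self_eq abs_sgn mult.commute)
  qed
  \<comment> \<open>The constant \<open>K\<close> is not known to be nonnegative, hence the absolute
    value.\<close>
  have bound: "f (p N) \<le> \<bar>K\<bar>" for N
  proof -
    have "nrm c0_space (p N) \<le> 1"
      by (rule nrm_c0_le) (auto simp: p_def s_def sgn_if)
    moreover have "0 \<le> nrm c0_space (p N)"
      using c0.nrm_nonneg p by simp
    ultimately have "K * nrm c0_space (p N) \<le> \<bar>K\<bar> * 1"
      by (intro mult_mono) auto
    with K[OF p, of N] show ?thesis by linarith
  qed
  have "summable (\<lambda>n. \<bar>f (c0_unit n)\<bar>)"
    by (rule summableI_nonneg_bounded[of _ "\<bar>K\<bar>"]) (use bound sum in auto)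
  then show ?thesis
    using summable_LIMSEQ_zero tendsto_rabs_zero_iff by blast
qed

section \<open>A weakly compact set\<close>

text \<open>The shift to \<open>Suc n\<close> leaves coordinate 0 free. The factor vanishes at n =
  0, so \<open>witness 0\<close> is the zero vector and the weak limit already lies in the
  range.\<close>

definition witness :: "nat \<Rightarrow> nat \<Rightarrow> real" where
  "witness n = (\<lambda>i. (real n / (real n + 1)) * c0_unit (Suc n) i)"

lemma witness_tendsto: "witness n \<longlonglongrightarrow> 0"
  unfolding witness_def by (intro tendsto_mult_right_zero c0_unit_tendsto)

lemma compactin_range_witness: "compactin (weak_topology c0_space) (range witness)"
proof -
  have "limitin (weak_topology c0_space) witness (witness 0) sequentially"
  proof (rule limitin_weak_topology)
    fix f assume f: "f \<in> dual_space c0_space"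
    then have "f (\<lambda>i. a * c0_unit m i) = a * f (c0_unit m)" for a m
      unfolding dual_space_def using c0_unit_tendsto by auto
    then have fw: "f (witness n) = (real n / (real n + 1)) * f (c0_unit (Suc n))" for n
      unfolding witness_def by blast
    have "(\<lambda>n. f (witness n)) \<longlonglongrightarrow> 0"
    proof (rule Lim_null_comparison)
      show "(\<lambda>n. \<bar>f (c0_unit (Suc n))\<bar>) \<longlonglongrightarrow> 0"
        using LIMSEQ_Suc[OF dual_c0_unit_tendsto[OF f]] by (rule tendsto_rabs_zero)
      show "\<forall>\<^sub>F n in sequentially. norm (f (witness n)) \<le> \<bar>f (c0_unit (Suc n))\<bar>"
      proof (intro always_eventually allI)
        fix n
        have "\<bar>real n / (real n + 1)\<bar> \<le> 1" by simp
        then show "norm (f (witness n)) \<le> \<bar>f (c0_unit (Suc n))\<bar>"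
          unfolding fw real_norm_def abs_mult by (intro mult_left_le_one_le) auto
      qed
    qed
    then show "(\<lambda>n. f (witness n)) \<longlonglongrightarrow> f (witness 0)"
      using fw[of 0] by simp
  qed (use witness_tendsto c0.normed_space_axioms in auto)
  \<comment> \<open>A convergent sequence together with its limit is compact; inserting the limit
    \<open>witness 0\<close> does not enlarge the range.\<close>
  then have "compactin (weak_topology c0_space) (insert (witness 0) (range witness))"
    by (rule compactin_sequence_with_limit)
       (use witness_tendsto in \<open>auto simp: c0.topspace_weak_topology\<close>)
  then show ?thesis by (simp add: insert_absorb)
qed

section \<open>No attainment in a ball around 3 e_0\<close>

lemma not_attains_sup_on_witness:
  assumes x: "x \<longlonglongrightarrow> 0" and near: "norm_dist c0_space (\<lambda>i. 3 * c0_unit 0 i) x < 1"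
  shows "\<not> attains_sup_on (\<lambda>z. nrm c0_space (z \<ominus>\<^bsub>c0_space\<^esub> x) + nrm c0_space z) (range witness)"
    (is "\<not> attains_sup_on ?g _")
proof
  have coord: "\<bar>3 * c0_unit 0 i - x i\<bar> < 1" for i
    using abs_diff_le_norm_dist_c0[OF tendsto_mult_right_zero[OF c0_unit_tendsto] x] near
    by (rule le_less_trans)
  have x0: "\<bar>x 0\<bar> > 2"
    using coord[of 0] by (simp add: c0_unit_def)
  \<comment> \<open>The centre vanishes off coordinate 0. Since
    \<bar>\<open>witness n i\<close>\<bar> \<le> 1, the differences there stay below 1 + 1 = 2 <
    \<bar>\<open>x 0\<close>\<bar>.\<close>
  have xi: "\<bar>x i\<bar> < 1" if "i \<noteq> 0" for i
    using coord[of i] that by (simp add: c0_unit_def)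
  have g: "?g (witness n) = \<bar>x 0\<bar> + real n / (real n + 1)" for n
  proof -
    \<comment> \<open>Every \<open>witness n\<close> is 0 at coordinate 0, so the supremum is
      attained there and does not depend on \<open>n\<close>.\<close>
    have "nrm c0_space (\<lambda>i. witness n i - x i) = \<bar>x 0\<bar>"
    proof (rule nrm_c0_eqI[where j = 0])
      fix i
      have "\<bar>witness n i\<bar> \<le> 1"
        by (simp add: witness_def c0_unit_def)
      then show "\<bar>witness n i - x i\<bar> \<le> \<bar>x 0\<bar>"
        using x0 xi[of i] by (cases "i = 0") (simp add: witness_def c0_unit_def, linarith)
    qed (simp add: witness_def c0_unit_def)
    moreover have "nrm c0_space (witness n) = real n / (real n + 1)"
      by (rule nrm_c0_eqI[where j = "Suc n"]) (auto simp: witness_def c0_unit_def)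
    ultimately show ?thesis
      by (simp add: c0_minus witness_tendsto x)
  qed
  assume "attains_sup_on ?g (range witness)"
  then obtain n where n: "ereal (?g (witness n)) = (SUP z\<in>range witness. ereal (?g z))"
    unfolding attains_sup_on_def by blast
  \<comment> \<open>Attainment at \<open>n\<close> would bound the value at \<open>Suc n\<close>,
    but n / (n + 1) is strictly increasing.\<close>
  have "ereal (?g (witness (Suc n))) \<le> ereal (?g (witness n))"
    unfolding n by (rule SUP_upper) simp
  then have "real (Suc n) / (real (Suc n) + 1) \<le> real n / (real n + 1)"
    unfolding g by simp
  then show False by (simp add: field_simps)
qed

theorem mainTheorem3:
  shows "\<exists>(X :: (nat \<Rightarrow> real) nvs) C.
           banach_space X \<and> C \<noteq> {} \<and> C \<subseteq> carrier X \<and> compactin (weak_topology X) C \<and>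
           norm_topology X closure_of
             {x \<in> carrier X. attains_sup_on (\<lambda>z. nrm X (z \<ominus>\<^bsub>X\<^esub> x) + nrm X z) C}
           \<noteq> carrier X"
proof (intro exI conjI)
  let ?A = "{x \<in> carrier c0_space. attains_sup_on
    (\<lambda>z. nrm c0_space (z \<ominus>\<^bsub>c0_space\<^esub> x) + nrm c0_space z) (range witness)}"
  let ?c = "\<lambda>i. 3 * c0_unit 0 i"
  \<comment> \<open>Density already fails at the centre 3 e_0: a point of its closure would have a
    member of \<open>?A\<close> in the ball of radius 1.\<close>
  have "?c \<notin> norm_topology c0_space closure_of ?A"
  proof
    assume "?c \<in> norm_topology c0_space closure_of ?A"
    then have "?c \<in> c0.mtopology closure_of ?A"
      by (simp add: norm_topology_def)
    then obtain y where "y \<in> ?A" "y \<in> c0.mball ?c 1"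
      unfolding c0.metric_closure_of by (auto dest: spec[of _ "1::real"])
    then show False
      using not_attains_sup_on_witness[of y] by auto
  qed
  moreover have "?c \<in> carrier c0_space"
    using tendsto_mult_right_zero[OF c0_unit_tendsto] by simp
  ultimately show "norm_topology c0_space closure_of ?A \<noteq> carrier c0_space" by blast
qed (use banach_space_c0 compactin_range_witness witness_tendsto in auto)

end
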